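(* Let $\Lambda$ be a finite alphabet and let $\mathcal{P}$ be any symmetric $\Lambda$-valued communication problem that has a constant-cost tandem $\textsc{Equality}$ protocol. Then for every constant $r$ there exists a constant $k$ such that every distance-$r$ composition of $\mathcal{P}$ reduces to $\textsc{HD}_k$; that is, there is a constant $c$ such that every problem $g[P_1\bullet\cdots\bullet P_n]$ (over all $n$, all $P_1,\dots,P_n\in\mathcal{P}$ and all permutation-invariant $g\colon\Lambda^{\le r}\to\Lambda$) satisfies $\mathsf{D}^{\textsc{HD}_k}(g[P_1\bullet\cdots\bullet P_n])\le c$.
   Context: $\mathcal{P}$ is a set of $\Lambda$-valued matrices; it is symmetric if every $P\in\mathcal{P}$ satisfies $P(x,y)=P(y,x)$. An $\textsc{Equality}$-oracle protocol for an $N\times N$ matrix $P$ is a deterministic protocol tree where each inner node $v$ has functions $a_v,b_v\colon[N]\to\mathbb{N}$ and on input $(x,y)$ branches according to whether $a_v(x)=b_v(y)$, and leaves are labeled by outputs; its cost is the tree depth. $\mathcal{P}$ has a constant-cost tandem $\textsc{Equality}$ protocol if there is a constant $c_0$ such that every $P\in\mathcal{P}$ has such a protocol of cost at most $c_0$ with $a_v=b_v$ at every node $v$. Distance-$r$ composition: for $P_1,\dots,P_n\in\mathcal{P}$, inputs $x=(x_1,\dots,x_n)$, $y=(y_1,\dots,y_n)$ with $x_i,y_i$ row/column indices of $P_i$, and permutation-invariant $g\colon\Lambda^{\le r}\to\Lambda$ (i.e. $g(u)=g(v)$ when $v$ is a permutation of $u$), $g[P_1\bullet\cdots\bullet P_n](x,y)=\bot$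 if more than $r$ indices $i$ have $x_i\ne y_i$, and otherwise equals $g$ applied to the sequence $(P_i(x_i,y_i): x_i\neq y_i)$. $\textsc{HD}_k$ is the family of matrices $\textsc{HD}_k^t(u,v)=1$ iff the Hamming distance of $u,v\in\{0,1\}^t$ is $k$. For a problem $P\colon\mathcal{X}\times\mathcal{Y}\to\Lambda'$, $\mathsf{D}^{\textsc{HD}_k}(P)$ is the minimum depth of a deterministic protocol tree whose inner nodes $v$ query a bit $\textsc{HD}_k^t(\phi_v(x),\psi_v(y))$ for some $t$ and maps $\phi_v,\psi_v$ into $\{0,1\}^t$, whose leaves are labeled by elements of $\Lambda'$, and which outputs $P(x,y)$ on every input. *)

theory Defs
  imports "Jordan_Normal_Form.Matrix" "HOL-Library.Extended_Nat" "HOL-Library.Multiset"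
begin

text \<open>
  Conventions: the alphabet is a type of class \<open>finite\<close> (an empty alphabet would admit no \<open>g\<close>);
  an \<open>N \<times> N\<close> matrix is an element of \<open>carrier_mat N N\<close>, with index set \<open>{0..<N}\<close>; bits are
  of type \<open>bool\<close>; the extra symbol for ``too far apart'' is \<open>None\<close>.
\<close>

subsection \<open>Deterministic protocol trees with oracle queries\<close>

text \<open>The first subtree of a node is taken if the oracle answers 1, the second one otherwise.\<close>

datatype (queries: 'q, 'l) protocol =
  Leaf 'l
| Node 'q "('q, 'l) protocol" "('q, 'l) protocol"

primrec cost :: "('q, 'l) protocol \<Rightarrow> nat" where
  "cost (Leaf l) = 0"
| "cost (Node q T1 T0) = Suc (max (cost T1) (cost T0))"

primrec run :: "('q \<Rightarrow> 'x \<Rightarrow> 'y \<Rightarrow> bool) \<Rightarrow> ('q, 'l) protocol \<Rightarrow> 'x \<Rightarrow> 'y \<Rightarrow> 'l" where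
  "run oracl (Leaf l) x y = l"
| "run oracl (Node q T1 T0) x y = (if oracl q x y then run oracl T1 x y else run oracl T0 x y)"

definition computes ::
  "('q \<Rightarrow> 'x \<Rightarrow> 'y \<Rightarrow> bool) \<Rightarrow> ('q, 'l) protocol \<Rightarrow> 'x set \<Rightarrow> 'y set \<Rightarrow> ('x \<Rightarrow> 'y \<Rightarrow> 'l) \<Rightarrow> bool" where
  "computes oracl T X Y P \<longleftrightarrow> (\<forall>x\<in>X. \<forall>y\<in>Y. run oracl T x y = P x y)"

subsection \<open>Equality protocols\<close>

type_synonym eq_query = "(nat \<Rightarrow> nat) \<times> (nat \<Rightarrow> nat)"

definition eq_oracle :: "eq_query \<Rightarrow> nat \<Rightarrow> nat \<Rightarrow> bool" where
  "eq_oracle = (\<lambda>(a, b) x y. a x = b y)"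

definition eq_protocol_for :: "(eq_query, 'l) protocol \<Rightarrow> nat \<Rightarrow> 'l mat \<Rightarrow> bool" where
  "eq_protocol_for T N P \<longleftrightarrow> computes eq_oracle T {..<N} {..<N} (\<lambda>x y. P $$ (x, y))"

text \<open>Only the restrictions of the query functions to \<open>{..<N}\<close> are meaningful.\<close>

definition tandem :: "nat \<Rightarrow> (eq_query, 'l) protocol \<Rightarrow> bool" where
  "tandem N T \<longleftrightarrow> (\<forall>(a, b)\<in>queries T. \<forall>x<N. a x = b x)"

definition constant_cost_tandem_eq :: "'l mat set \<Rightarrow> bool" where
  "constant_cost_tandem_eq \<P> \<longleftrightarrow>
     (\<exists>c0. \<forall>P\<in>\<P>. \<exists>T. eq_protocol_for T (dim_row P) P \<and> tandem (dim_row P) T \<and> cost T \<le> c0)"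

definition symmetric_problem :: "'l mat set \<Rightarrow> bool" where
  "symmetric_problem \<P> \<longleftrightarrow>
     (\<forall>P\<in>\<P>. \<forall>x<dim_row P. \<forall>y<dim_row P. P $$ (x, y) = P $$ (y, x))"

subsection \<open>Distance-r compositions\<close>

definition comp_inputs :: "'l mat list \<Rightarrow> nat list set" where
  "comp_inputs Ps = {x. length x = length Ps \<and> (\<forall>i<length Ps. x ! i < dim_row (Ps ! i))}"

text \<open>
  A function on sequences of length at most \<open>r\<close> is a function on all lists whose values on longer
  lists are irrelevant.
\<close>

definition perm_invariant :: "nat \<Rightarrow> ('l list \<Rightarrow> 'l) \<Rightarrow> bool" where
  "perm_invariant r g \<longleftrightarrow> (\<forall>u v. length u \<le> r \<and> mset u = mset v \<longrightarrow> g u = g v)"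

definition distance_composition ::
  "nat \<Rightarrow> ('l list \<Rightarrow> 'l) \<Rightarrow> 'l mat list \<Rightarrow> nat list \<Rightarrow> nat list \<Rightarrow> 'l option" where
  "distance_composition r g Ps x y =
     (let D = filter (\<lambda>i. x ! i \<noteq> y ! i) [0..<length Ps]
      in if length D > r then None
         else Some (g (map (\<lambda>i. (Ps ! i) $$ (x ! i, y ! i)) D)))"

subsection \<open>k-Hamming distance and protocols querying it\<close>

definition cube :: "nat \<Rightarrow> bool list set" where
  "cube t = {u. length u = t}"

definition HD :: "nat \<Rightarrow> nat \<Rightarrow> bool list \<Rightarrow> bool list \<Rightarrow> bool" where
  "HD k t u v \<longleftrightarrow> card {i. i < t \<and> u ! i \<noteq> v ! i} = k"

type_synonym ('x, 'y) hd_query = "nat \<times> ('x \<Rightarrow> bool list) \<times> ('y \<Rightarrow> bool list)"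

definition hd_oracle :: "nat \<Rightarrow> ('x, 'y) hd_query \<Rightarrow> 'x \<Rightarrow> 'y \<Rightarrow> bool" where
  "hd_oracle k = (\<lambda>(t, \<phi>, \<psi>) x y. HD k t (\<phi> x) (\<psi> y))"

definition hd_protocol :: "'x set \<Rightarrow> 'y set \<Rightarrow> (('x, 'y) hd_query, 'l) protocol \<Rightarrow> bool" where
  "hd_protocol X Y T \<longleftrightarrow> (\<forall>(t, \<phi>, \<psi>)\<in>queries T. \<phi> ` X \<subseteq> cube t \<and> \<psi> ` Y \<subseteq> cube t)"

text \<open>
  An infimum in \<open>enat\<close>: it is attained if some protocol computes \<open>P\<close>, and is \<open>\<infinity>\<close> otherwise.
\<close>

definition D_HD :: "nat \<Rightarrow> 'x set \<Rightarrow> 'y set \<Rightarrow> ('x \<Rightarrow> 'y \<Rightarrow> 'l) \<Rightarrow> enat" where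
  "D_HD k X Y P =
     (INF T\<in>{T. hd_protocol X Y T \<and> computes (hd_oracle k) T X Y P}. enat (cost T))"

end

theory Submission
  imports Defs "HOL-Library.Nat_Bijection"
begin

text \<open>
  For a labelling \<open>l\<close> of the indices, the indicator of \<open>l x \<noteq> l y\<close> is half the Hamming distance of
  the one-hot encodings of \<open>l x\<close> and \<open>l y\<close>. The product of two such indicators is
  \<open>[a \<noteq>] * [l \<noteq>] = [a \<noteq>] + [l \<noteq>] - [(a, l) \<noteq>]\<close>, so by induction on a tandem protocol the indicator
  of ``\<open>x \<noteq> y\<close> and the output is \<open>s\<close>'' is a difference of two sums of boundedly many such indicators.
  Summed over the coordinates, the number of occurrences of \<open>s\<close> is half the difference of two Hamming
  distances. These are bounded when at most \<open>r\<close> coordinates differ, so non-adaptive queries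
  find them; equality to a smaller distance than \<open>k\<close> is tested by padding with differing bits.
\<close>

section \<open>Tandem protocols as differences of label comparisons\<close>

text \<open>Labels form a list rather than a set because repetitions serve as positive integer
  coefficients.\<close>

definition sep :: "('a \<Rightarrow> nat) list \<Rightarrow> 'a \<Rightarrow> 'a \<Rightarrow> nat" where
  "sep L x y = length (filter (\<lambda>l. l x \<noteq> l y) L)"

lemma sep_Nil [simp]: "sep [] x y = 0"
  and sep_Cons [simp]: "sep (l # L) x y = of_bool (l x \<noteq> l y) + sep L x y"
  and sep_append [simp]: "sep (L @ L') x y = sep L x y + sep L' x y"
  by (simp_all add: sep_def)

lemma sep_replicate [simp]: "sep (replicate m l) x y = m * of_bool (l x \<noteq> l y)"
  by (induction m) auto

lemma sep_le_length: "sep L x y \<le> length L"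
  by (simp add: sep_def)

lemma sep_same [simp]: "sep L x x = 0"
  by (simp add: sep_def)

text \<open>By injectivity of \<open>prod_encode\<close>, each pair differs as soon as the values of
  \<open>a\<close> do, and otherwise exactly when the values of \<open>l\<close> do.\<close>

lemma sep_map_pair:
  "sep (map (\<lambda>l z. prod_encode (a z, l z)) L) x y = (if a x = a y then sep L x y else length L)"
  by (induction L) auto

text \<open>Every \<open>sep\<close> vanishes on the diagonal, hence the conjunct
  \<open>x \<noteq> y\<close>. If I1 and I0 are the indicators for the subtrees, that of a node is
  I1 + [a \<noteq>] * (I0 - I1), to which the product rule applies. Negative terms change sides so
  that everything stays in \<open>nat\<close>.\<close>

lemma tandem_indicator_as_difference:
  assumes "tandem N T"
  shows "\<exists>p n. length p \<le> 7 ^ cost T \<and> length n \<le> 7 ^ cost T \<and>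
    (\<forall>x<N. \<forall>y<N. of_bool (x \<noteq> y \<and> run eq_oracle T x y = s) + sep n x y = sep p x y)"
  using assms
proof (induction T)
  case (Leaf s')
  show ?case
    by (rule exI[of _ "if s' = s then [id] else []"], rule exI[of _ "[]"]) auto
next
  case (Node q T1 T0)
  obtain a b where q: "q = (a, b)" by (cases q)
  have ab: "a x = b x" if "x < N" for x
    using Node.prems that by (auto simp: tandem_def q)
  from Node obtain p1 n1 where 1:
    "length p1 \<le> 7 ^ cost T1" "length n1 \<le> 7 ^ cost T1"
    "\<And>x y. x < N \<Longrightarrow> y < N \<Longrightarrow>
       of_bool (x \<noteq> y \<and> run eq_oracle T1 x y = s) + sep n1 x y = sep p1 x y"
    by (fastforce simp: tandem_def)
  from Node obtain p0 n0 where 0: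
    "length p0 \<le> 7 ^ cost T0" "length n0 \<le> 7 ^ cost T0"
    "\<And>x y. x < N \<Longrightarrow> y < N \<Longrightarrow>
       of_bool (x \<noteq> y \<and> run eq_oracle T0 x y = s) + sep n0 x y = sep p0 x y"
    by (fastforce simp: tandem_def)
  let ?M = "7 ^ max (cost T1) (cost T0) :: nat"
  have "7 ^ cost T1 \<le> ?M" "7 ^ cost T0 \<le> ?M"
    by (auto intro: power_increasing)
  with 1 0 have M: "length p1 \<le> ?M" "length n1 \<le> ?M" "length p0 \<le> ?M" "length n0 \<le> ?M"
    by linarith+
  let ?c = "map (\<lambda>l z. prod_encode (a z, l z))"
  let ?r = "\<lambda>L. replicate (length L) a"
  \<comment> \<open>Here \<open>?r L\<close>, \<open>L\<close> and \<open>?c L\<close> stand for the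
    three terms of [a \<noteq>] * \<open>sep L\<close>. Each of \<open>p\<close> and
    \<open>n\<close> has seven blocks of length at most \<open>?M\<close>, whence the base
    7.\<close>
  define p where "p = p1 @ ?r p0 @ p0 @ ?c n0 @ ?c p1 @ ?r n1 @ n1"
  define n where "n = n1 @ ?c p0 @ ?r n0 @ n0 @ ?r p1 @ p1 @ ?c n1"
  have "length p \<le> 7 ^ cost (Node q T1 T0)" "length n \<le> 7 ^ cost (Node q T1 T0)"
    using M by (auto simp: p_def n_def)
  moreover have "of_bool (x \<noteq> y \<and> run eq_oracle (Node q T1 T0) x y = s) + sep n x y = sep p x y"
    if xy: "x < N" "y < N" for x y
  proof (cases "a x = a y")
    case True
    with 1(3)[OF xy] xy show ?thesis
      by (simp add: p_def n_def sep_map_pair q eq_oracle_def ab)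
  next
    case False
    with 0(3)[OF xy] xy show ?thesis
      by (simp add: p_def n_def sep_map_pair q eq_oracle_def ab)
  qed
  ultimately show ?case by blast
qed

section \<open>Protocols that ask a fixed list of queries\<close>

lemma nonadaptive_protocol:
  assumes "\<And>x y. x \<in> X \<Longrightarrow> y \<in> Y \<Longrightarrow> P x y = F (map (\<lambda>q. oracl q x y) Q)"
  shows "\<exists>T. cost T \<le> length Q \<and> queries T \<subseteq> set Q \<and> computes oracl T X Y P"
proof -
  have "\<exists>T. cost T \<le> length Q \<and> queries T \<subseteq> set Q \<and>
    (\<forall>x y. run oracl T x y = F (map (\<lambda>q. oracl q x y) Q))"
  proof (induction Q arbitrary: F)
    case Nil
    show ?case by (rule exI[of _ "Leaf (F [])"]) simp
  next
    case (Cons q Q)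
    obtain T1 where 1: "cost T1 \<le> length Q" "queries T1 \<subseteq> set Q"
      "\<forall>x y. run oracl T1 x y = F (True # map (\<lambda>q. oracl q x y) Q)"
      using Cons[of "\<lambda>l. F (True # l)"] by blast
    obtain T0 where 0: "cost T0 \<le> length Q" "queries T0 \<subseteq> set Q"
      "\<forall>x y. run oracl T0 x y = F (False # map (\<lambda>q. oracl q x y) Q)"
      using Cons[of "\<lambda>l. F (False # l)"] by blast
    show ?case
      by (rule exI[of _ "Node q T1 T0"]) (use 1 0 in auto)
  qed
  then show ?thesis using assms by (simp add: computes_def) metis
qed

text \<open>By \<open>det\<close> the problem factors through the list of answers, so asking all of
  \<open>Q\<close> in order suffices.\<close>

lemma D_HD_le_length:
  assumes cube: "\<And>t \<phi> \<psi>. (t, \<phi>, \<psi>) \<in> set Q \<Longrightarrow> \<phi> ` X \<subseteq> cube t \<and> \<psi> ` Y \<subseteq> cube t"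
    and det: "\<And>x y x' y'. \<lbrakk>x \<in> X; y \<in> Y; x' \<in> X; y' \<in> Y;
      \<And>q. q \<in> set Q \<Longrightarrow> hd_oracle k q x y = hd_oracle k q x' y'\<rbrakk> \<Longrightarrow> P x y = P x' y'"
  shows "D_HD k X Y P \<le> enat (length Q)"
proof -
  let ?ans = "\<lambda>x y. map (\<lambda>q. hd_oracle k q x y) Q"
  \<comment> \<open>On answer lists that no input pair produces, the value is arbitrary and never
    reached.\<close>
  define F where "F l = (SOME v. \<exists>x\<in>X. \<exists>y\<in>Y. ?ans x y = l \<and> v = P x y)" for l
  have "P x y = F (?ans x y)" if xy: "x \<in> X" "y \<in> Y" for x y
  proof -
    have "\<exists>x'\<in>X. \<exists>y'\<in>Y. ?ans x' y' = ?ans x y \<and> F (?ans x y) = P x' y'"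
      unfolding F_def by (rule someI_ex) (use xy in blast)
    then show ?thesis using det[OF xy] by (auto simp: map_eq_conv)
  qed
  then obtain T where T: "cost T \<le> length Q" "queries T \<subseteq> set Q" "computes (hd_oracle k) T X Y P"
    using nonadaptive_protocol[of X Y P F "hd_oracle k" Q] by blast
  have "case q of (t, \<phi>, \<psi>) \<Rightarrow> \<phi> ` X \<subseteq> cube t \<and> \<psi> ` Y \<subseteq> cube t" if "q \<in> queries T" for q
    by (cases q) (use subsetD[OF T(2) that] in \<open>simp add: cube\<close>)
  then have "hd_protocol X Y T"
    unfolding hd_protocol_def by (rule ballI)
  then have "D_HD k X Y P \<le> enat (cost T)"
    unfolding D_HD_def using T(3) by (intro INF_lower) simp
  also have "\<dots> \<le> enat (length Q)" using T(1) by simp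
  finally show ?thesis .
qed

section \<open>Hamming distances of one-hot encodings\<close>

definition bits_dist :: "('x \<Rightarrow> bool) list \<Rightarrow> 'x \<Rightarrow> 'x \<Rightarrow> nat" where
  "bits_dist B x y = length (filter (\<lambda>b. b x \<noteq> b y) B)"

text \<open>The \<open>k - j\<close> extra positions differ for all inputs, so total distance
  \<open>k\<close> means distance \<open>j\<close> on \<open>B\<close>; this presupposes
  \<open>j \<le> k\<close>, as the subtraction truncates.\<close>

definition padded_query :: "nat \<Rightarrow> ('x \<Rightarrow> bool) list \<Rightarrow> nat \<Rightarrow> ('x, 'x) hd_query" where
  "padded_query k B j =
     (length B + (k - j), \<lambda>x. map (\<lambda>b. b x) B @ replicate (k - j) True,
      \<lambda>y. map (\<lambda>b. b y) B @ replicate (k - j) False)"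

lemma card_differences:
  assumes "length u = t" "length v = t"
  shows "card {i. i < t \<and> u ! i \<noteq> v ! i} = length (filter (\<lambda>(a, b). a \<noteq> b) (zip u v))"
  using assms by (auto simp: length_filter_conv_card intro!: arg_cong[where f = card])

lemma hd_oracle_padded_query:
  assumes "j \<le> k"
  shows "hd_oracle k (padded_query k B j) x y \<longleftrightarrow> bits_dist B x y = j"
proof -
  let ?u = "map (\<lambda>b. b x) B @ replicate (k - j) True"
  let ?v = "map (\<lambda>b. b y) B @ replicate (k - j) False"
  have "card {i. i < length B + (k - j) \<and> ?u ! i \<noteq> ?v ! i}
      = length (filter (\<lambda>(a, b). a \<noteq> b) (zip ?u ?v))"
    by (rule card_differences) simp_all
  also have "\<dots> = bits_dist B x y + (k - j)"
    by (simp add: bits_dist_def zip_map_map zip_same_conv_map filter_map o_def)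
  finally show ?thesis
    using assms by (auto simp: hd_oracle_def padded_query_def HD_def)
qed

text \<open>\<open>remdups\<close> gives each attained label value a single position, even if
  several indices share it.\<close>

definition one_hot :: "nat \<Rightarrow> nat \<Rightarrow> (nat \<Rightarrow> nat) \<Rightarrow> (nat list \<Rightarrow> bool) list" where
  "one_hot N i l = map (\<lambda>v x. l (x ! i) = v) (remdups (map l [0..<N]))"

definition coordinate_bits ::
  "nat \<Rightarrow> (nat \<Rightarrow> nat) \<Rightarrow> (nat \<Rightarrow> (nat \<Rightarrow> nat) list) \<Rightarrow> (nat list \<Rightarrow> bool) list" where
  "coordinate_bits n N L = concat (map (\<lambda>i. concat (map (one_hot (N i) i) (L i))) [0..<n])"

lemma bits_dist_Nil [simp]: "bits_dist [] x y = 0"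
  and bits_dist_append [simp]: "bits_dist (B @ B') x y = bits_dist B x y + bits_dist B' x y"
  by (simp_all add: bits_dist_def)

text \<open>Two distinct labels disagree exactly at their own two positions, both of which exist
  because the indices lie below \<open>N\<close>.\<close>

lemma bits_dist_one_hot:
  assumes "x ! i < N" "y ! i < N"
  shows "bits_dist (one_hot N i l) x y = 2 * of_bool (l (x ! i) \<noteq> l (y ! i))"
proof -
  let ?D = "{v \<in> set (remdups (map l [0..<N])). (l (x ! i) = v) \<noteq> (l (y ! i) = v)}"
  have "bits_dist (one_hot N i l) x y
      = length (filter (\<lambda>v. (l (x ! i) = v) \<noteq> (l (y ! i) = v)) (remdups (map l [0..<N])))"
    unfolding bits_dist_def one_hot_def filter_map o_def length_map ..
  also have "\<dots> = card ?D"
    by (subst distinct_card[symmetric]) (simp_all only: distinct_filter distinct_remdups set_filter)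
  also have "?D = (if l (x ! i) = l (y ! i) then {} else {l (x ! i), l (y ! i)})"
    using assms by auto
  finally show ?thesis by auto
qed

lemma bits_dist_coordinate_bits:
  assumes "\<And>i. i < n \<Longrightarrow> x ! i < N i" "\<And>i. i < n \<Longrightarrow> y ! i < N i"
  shows "bits_dist (coordinate_bits n N L) x y = 2 * (\<Sum>i<n. sep (L i) (x ! i) (y ! i))"
  using assms
proof (induction n)
  case 0
  show ?case by (simp add: coordinate_bits_def)
next
  case (Suc n)
  have "bits_dist (concat (map (one_hot (N n) n) M)) x y = 2 * sep M (x ! n) (y ! n)" for M
    by (induction M) (use Suc.prems in \<open>simp_all add: bits_dist_one_hot\<close>)
  moreover have "bits_dist (coordinate_bits n N L) x y = 2 * (\<Sum>i<n. sep (L i) (x ! i) (y ! i))"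
    by (rule Suc.IH) (use Suc.prems in auto)
  ultimately show ?case by (simp add: coordinate_bits_def)
qed

section \<open>Recovering the composition from boundedly many distances\<close>

lemma length_filter_upt: "length (filter R [0..<n]) = (\<Sum>i<n. of_bool (R i))"
  by (induction n) auto

lemma count_mset_map_filter_upt:
  "count (mset (map f (filter R [0..<n]))) s = (\<Sum>i<n. of_bool (R i \<and> f i = s))"
  by (induction n) auto

theorem theoremB2:
  fixes \<P> :: "'l::finite mat set"
  assumes square: "\<And>P. P \<in> \<P> \<Longrightarrow> square_mat P"
    and symmetric: "symmetric_problem \<P>"
    and tandem: "constant_cost_tandem_eq \<P>"
  shows "\<forall>r. \<exists>k c. \<forall>Ps g. set Ps \<subseteq> \<P> \<and> perm_invariant r g \<longrightarrow>
           D_HD k (comp_inputs Ps) (comp_inputs Ps) (distance_composition r g Ps) \<le> enat c"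
proof
  fix r
  obtain c0 where c0: "\<And>P. P \<in> \<P> \<Longrightarrow>
      \<exists>T. eq_protocol_for T (dim_row P) P \<and> Defs.tandem (dim_row P) T \<and> cost T \<le> c0"
    using tandem by (auto simp: constant_cost_tandem_eq_def)
  define C :: nat where "C = 7 ^ c0"
  have "\<exists>p n. length p \<le> C \<and> length n \<le> C \<and> (\<forall>x<dim_row P. \<forall>y<dim_row P.
      of_bool (x \<noteq> y \<and> P $$ (x, y) = s) + sep n x y = sep p x y)" if P: "P \<in> \<P>" for P s
  proof -
    obtain T where T: "eq_protocol_for T (dim_row P) P" "Defs.tandem (dim_row P) T" "cost T \<le> c0"
      using c0[OF P] by blast
    have "7 ^ cost T \<le> C"
      unfolding C_def using T(3) by (intro power_increasing) auto
    moreover obtain p n where "length p \<le> 7 ^ cost T" "length n \<le> 7 ^ cost T"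
      "\<forall>x<dim_row P. \<forall>y<dim_row P.
         of_bool (x \<noteq> y \<and> run eq_oracle T x y = s) + sep n x y = sep p x y"
      using tandem_indicator_as_difference[OF T(2)] by blast
    ultimately show ?thesis
      using T(1) by (intro exI[of _ p] exI[of _ n]) (auto simp: eq_protocol_for_def computes_def)
  qed
  then obtain pos neg where pn:
    "\<And>P s. P \<in> \<P> \<Longrightarrow> length (pos P s) \<le> C" "\<And>P s. P \<in> \<P> \<Longrightarrow> length (neg P s) \<le> C"
    "\<And>P s x y. \<lbrakk>P \<in> \<P>; x < dim_row P; y < dim_row P\<rbrakk> \<Longrightarrow>
       of_bool (x \<noteq> y \<and> P $$ (x, y) = s) + sep (neg P s) x y = sep (pos P s) x y"
    by metis
  \<comment> \<open>At most \<open>r\<close> coordinates differ, each is separated by at most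
    \<open>C\<close> labels, and each separation costs two bits.\<close>
  define k where "k = 2 * (r * C)"
  obtain ss :: "'l list" where ss: "set ss = UNIV"
    using finite_list[of "UNIV :: 'l set"] by auto
  \<comment> \<open>One encoding measures the number of differing coordinates and two belong to each
    entry of \<open>ss\<close>; each is tested against the distances 0 to \<open>k\<close>.\<close>
  define c where "c = Suc (2 * length ss) * Suc k"
  have "D_HD k (comp_inputs Ps) (comp_inputs Ps) (distance_composition r g Ps) \<le> enat c"
    if Ps: "set Ps \<subseteq> \<P>" and g: "perm_invariant r g" for Ps g
  proof -
    define n where "n = length Ps"
    define N where "N i = dim_row (Ps ! i)" for i
    define bits where "bits = coordinate_bits n N"
    define Bs where "Bs = bits (\<lambda>_. [id]) #
      map (\<lambda>s. bits (\<lambda>i. pos (Ps ! i) s)) ss @ map (\<lambda>s. bits (\<lambda>i. neg (Ps ! i) s)) ss"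
    define Q where "Q = concat (map (\<lambda>B. map (padded_query k B) [0..<Suc k]) Bs)"
    have "length Q = sum_list (map (\<lambda>B. Suc k) Bs)"
      by (simp add: Q_def length_concat o_def)
    also have "\<dots> = c"
      by (simp add: sum_list_triv o_def c_def Bs_def)
    finally have lenQ: "length Q = c" .
    let ?X = "comp_inputs Ps"
    define A where "A x y = filter (\<lambda>i. x ! i \<noteq> y ! i) [0..<n]" for x y :: "nat list"
    define V where "V x y = map (\<lambda>i. (Ps ! i) $$ (x ! i, y ! i)) (A x y)" for x y
    have P: "Ps ! i \<in> \<P>" if "i < n" for i
      using Ps that by (auto simp: n_def)
    have dist: "bits_dist (bits L) x y = 2 * (\<Sum>i<n. sep (L i) (x ! i) (y ! i))"
      if "x \<in> ?X" "y \<in> ?X" for x y L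
      unfolding bits_def
      by (rule bits_dist_coordinate_bits) (use that in \<open>auto simp: comp_inputs_def n_def N_def\<close>)
    have lenA: "length (A x y) = (\<Sum>i<n. sep [id] (x ! i) (y ! i))" for x y
      by (simp add: A_def length_filter_upt)
    have bound: "bits_dist (bits L) x y \<le> k"
      if xy: "x \<in> ?X" "y \<in> ?X" and L: "\<And>i. i < n \<Longrightarrow> length (L i) \<le> C" and r: "length (A x y) \<le> r"
      for L x y
    proof -
      \<comment> \<open>\<open>sep [id]\<close> indicates that a coordinate differs; coordinates
        that agree contribute nothing to either side.\<close>
      have "(\<Sum>i<n. sep (L i) (x ! i) (y ! i)) \<le> (\<Sum>i<n. sep [id] (x ! i) (y ! i) * C)"
        by (intro sum_mono) (auto intro: le_trans[OF sep_le_length] L)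
      also have "\<dots> = length (A x y) * C" by (simp add: lenA sum_distrib_right)
      also have "\<dots> \<le> r * C" using r by simp
      finally show ?thesis by (simp add: dist[OF xy] k_def)
    qed
    \<comment> \<open>The indicator identity for each \<open>Ps ! i\<close> is summed over the
      coordinates; the factor 2 comes from the one-hot encoding.\<close>
    have count: "2 * count (mset (V x y)) s + bits_dist (bits (\<lambda>i. neg (Ps ! i) s)) x y
        = bits_dist (bits (\<lambda>i. pos (Ps ! i) s)) x y" if xy: "x \<in> ?X" "y \<in> ?X" for x y s
    proof -
      have "count (mset (V x y)) s + (\<Sum>i<n. sep (neg (Ps ! i) s) (x ! i) (y ! i))
          = (\<Sum>i<n. sep (pos (Ps ! i) s) (x ! i) (y ! i))"
        unfolding V_def A_def count_mset_map_filter_upt sum.distrib[symmetric]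
        by (intro sum.cong refl pn(3) P) (use xy in \<open>auto simp: comp_inputs_def n_def\<close>)
      then show ?thesis by (simp add: dist[OF xy] flip: distrib_left)
    qed
    have same: "length (A x' y') \<le> r \<and> mset (V x y) = mset (V x' y')"
      if xy: "x \<in> ?X" "y \<in> ?X" and xy': "x' \<in> ?X" "y' \<in> ?X"
        and ans: "\<And>q. q \<in> set Q \<Longrightarrow> hd_oracle k q x y = hd_oracle k q x' y'"
        and r: "length (A x y) \<le> r" for x y x' y'
    proof -
      \<comment> \<open>For the close pair the distance is at most \<open>k\<close>, so some query
        tests exactly this value. Its positive answer carries over to the other pair, for which no
        bound is known beforehand.\<close>
      have eq: "bits_dist (bits L) x' y' = bits_dist (bits L) x y"
        if B: "bits L \<in> set Bs" and L: "\<And>i. i < n \<Longrightarrow> length (L i) \<le> C" for L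
      proof -
        let ?j = "bits_dist (bits L) x y"
        have j: "?j \<le> k" using bound[OF xy L r] .
        then have "padded_query k (bits L) ?j \<in> set Q"
          unfolding Q_def set_concat set_map image_image
          by (intro UN_I[OF B] imageI) auto
        from ans[OF this] show ?thesis by (simp add: hd_oracle_padded_query[OF j])
      qed
      have "bits_dist (bits (\<lambda>_. [id])) x' y' = bits_dist (bits (\<lambda>_. [id])) x y"
        \<comment> \<open>The list \<open>[id]\<close> has length 1, which is at most
          \<open>C\<close>, a power of 7.\<close>
        by (rule eq) (auto simp: Bs_def C_def)
      then have "length (A x' y') = length (A x y)"
        unfolding lenA dist[OF xy] dist[OF xy'] by simp
      moreover have "count (mset (V x y)) s = count (mset (V x' y')) s" for s
      proof -
        have "bits_dist (bits (\<lambda>i. pos (Ps ! i) s)) x' y' = bits_dist (bits (\<lambda>i. pos (Ps ! i) s)) x y"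
          "bits_dist (bits (\<lambda>i. neg (Ps ! i) s)) x' y' = bits_dist (bits (\<lambda>i. neg (Ps ! i) s)) x y"
          by (rule eq; auto simp: Bs_def ss intro: pn P)+
        with count[OF xy, of s] count[OF xy', of s] show ?thesis by linarith
      qed
      ultimately show ?thesis using r by (auto intro: multiset_eqI)
    qed
    have comp: "distance_composition r g Ps x y
        = (if length (A x y) > r then None else Some (g (V x y)))" for x y
      by (simp add: distance_composition_def A_def V_def n_def)
    have "D_HD k ?X ?X (distance_composition r g Ps) \<le> enat (length Q)"
    proof (rule D_HD_le_length)
      show "\<phi> ` ?X \<subseteq> cube t \<and> \<psi> ` ?X \<subseteq> cube t" if "(t, \<phi>, \<psi>) \<in> set Q" for t \<phi> \<psi>
        using that by (auto simp: Q_def padded_query_def cube_def)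
    next
      fix x y x' y'
      assume *: "x \<in> ?X" "y \<in> ?X" "x' \<in> ?X" "y' \<in> ?X"
        and ans: "\<And>q. q \<in> set Q \<Longrightarrow> hd_oracle k q x y = hd_oracle k q x' y'"
      show "distance_composition r g Ps x y = distance_composition r g Ps x' y'"
      proof (cases "length (A x y) \<le> r")
        case True
        with same[OF * ans] have "length (A x' y') \<le> r" "mset (V x y) = mset (V x' y')" by auto
        moreover have "length (V x y) \<le> r" using True by (simp add: V_def)
        ultimately show ?thesis
          using True g unfolding perm_invariant_def comp by auto
      next
        case False
        \<comment> \<open>With the pairs exchanged: if the second pair were close, the equal answers
          would make the first one close too. So both values are \<open>None\<close>.\<close>
        with same[OF *(3,4,1,2) ans[symmetric]] have "\<not> length (A x' y') \<le> r" by blast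
        with False show ?thesis by (simp add: comp)
      qed
    qed
    then show ?thesis by (simp add: lenQ)
  qed
  then show "\<exists>k c. \<forall>Ps g. set Ps \<subseteq> \<P> \<and> perm_invariant r g \<longrightarrow>
           D_HD k (comp_inputs Ps) (comp_inputs Ps) (distance_composition r g Ps) \<le> enat c"
    by blast
qed

end
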